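(* Let $n,L,\kappa$ be positive integers and consider the linear operator $U_n:\mathcal{R}(L,\kappa)\to\mathcal{R}(L,\kappa)$. Then $$\dim\ker(U_n)=L-\frac{L}{\gcd(n,L)}.$$
   Context: $\mathcal{R}(L,\kappa)$ is the complex vector space of rational functions over $\mathbb{C}$, analytic at the origin, whose Taylor series has the form $\sum_{k\ge0}k^{\kappa-1}a(k)x^k$ with $a(k+L)=a(k)$ for all $k\ge0$ (with $0^0=1$). $U_n\left(\sum_{k\ge 0}b(k)x^k\right)=\sum_{k\ge 0}b(nk)x^k$. *)

theory Defs
  imports "HOL-Complex_Analysis.Complex_Analysis"
    "HOL-Computational_Algebra.Polynomial_Factorial"
    "HOL-Computational_Algebra.Field_as_Ring"
begin

type_synonym ratfun = "complex poly fract"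

text \<open>
  The value is computed from the representation in lowest terms. At a pole it is the junk value 0,
  so the evaluation function is not even continuous there; hence being analytic at 0 in the sense
  of the library means exactly that 0 is not a pole (see \<open>ratfun_analytic_iff\<close> below).
\<close>
definition ratfun_eval :: "ratfun \<Rightarrow> complex \<Rightarrow> complex" where
  "ratfun_eval f z = poly (fst (quot_of_fract f)) z / poly (snd (quot_of_fract f)) z"

definition ratfun_analytic :: "ratfun \<Rightarrow> bool" where
  "ratfun_analytic f \<longleftrightarrow> ratfun_eval f analytic_on {0}"

definition ratfun_taylor :: "ratfun \<Rightarrow> complex fps" where
  "ratfun_taylor f = fps_expansion (ratfun_eval f) 0"

definition ratfun_scale :: "complex \<Rightarrow> ratfun \<Rightarrow> ratfun" where
  "ratfun_scale c f = to_fract [:c:] * f"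

text \<open>
  Pitfall: \<open>ratfun_dim\<close> is the library's \<open>vector_space.dim\<close>, whose value on a space of infinite
  dimension is 0; equations about it should be accompanied by finite dimensionality.
\<close>
global_interpretation ratfun: vector_space ratfun_scale
  defines ratfun_dim = ratfun.dim and ratfun_span = ratfun.span
    and ratfun_subspace = ratfun.subspace
proof
  have add: "[:c + d:] = [:c:] + [:d:]" for c d :: complex
    by simp
  have mult: "[:c * d:] = [:c:] * [:d:]" for c d :: complex
    by simp
  have one: "[:1:] = (1 :: complex poly)"
    by simp
  fix a b :: complex and x y :: ratfun
  show "ratfun_scale a (x + y) = ratfun_scale a x + ratfun_scale a y"
    by (simp add: ratfun_scale_def ring_distribs)
  show "ratfun_scale (a + b) x = ratfun_scale a x + ratfun_scale b x"
    unfolding ratfun_scale_def add to_fract_add by (simp add: ring_distribs)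
  show "ratfun_scale a (ratfun_scale b x) = ratfun_scale (a * b) x"
    unfolding ratfun_scale_def mult to_fract_mult by (simp add: mult_ac)
  show "ratfun_scale 1 x = x"
    unfolding ratfun_scale_def one by simp
qed

text \<open>In HOL \<open>0 ^ 0 = 1\<close>, so the constant coefficient for \<open>\<kappa> = 1\<close> is \<open>a 0\<close>.\<close>
definition RLk :: "nat \<Rightarrow> nat \<Rightarrow> ratfun set" where
  "RLk L \<kappa> = {f. ratfun_analytic f \<and>
     (\<exists>a :: nat \<Rightarrow> complex. (\<forall>k. a (k + L) = a k) \<and>
        ratfun_taylor f = Abs_fps (\<lambda>k. of_nat k ^ (\<kappa> - 1) * a k))}"

definition U_series :: "nat \<Rightarrow> complex fps \<Rightarrow> complex fps" where
  "U_series n F = Abs_fps (\<lambda>k. fps_nth F (n * k))"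

text \<open>
  On rational functions, \<open>U n f\<close> is the rational function whose Taylor series is \<open>U_series n\<close> of
  that of \<open>f\<close>. The lemmas \<open>U_op_in_RLk\<close> and \<open>ratfun_taylor_U_op\<close> below show that the description
  is proper for the elements of \<open>RLk L \<kappa>\<close> and that the operator maps this space into itself.
\<close>
definition U_op :: "nat \<Rightarrow> ratfun \<Rightarrow> ratfun" where
  "U_op n f = (THE g. ratfun_analytic g \<and> ratfun_taylor g = U_series n (ratfun_taylor f))"

definition U_ker :: "nat \<Rightarrow> nat \<Rightarrow> nat \<Rightarrow> ratfun set" where
  "U_ker n L \<kappa> = {f \<in> RLk L \<kappa>. U_op n f = 0}"


subsection \<open>Taylor series of rational functions\<close>

lemma ratfun_eval_Fract:
  assumes "poly q z \<noteq> 0"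
  shows "ratfun_eval (Fract p q) z = poly p z / poly q z"
    and "poly (snd (quot_of_fract (Fract p q))) z \<noteq> 0"
proof -
  define p' where "p' = fst (quot_of_fract (Fract p q))"
  define q' where "q' = snd (quot_of_fract (Fract p q))"
  have q: "q \<noteq> 0" using assms by auto
  have q': "q' \<noteq> 0" by (simp add: q'_def)
  have "Fract p' q' = Fract p q"
    by (simp add: p'_def q'_def)
  then have eq: "p' * q = p * q'"
    using q q' by (simp add: eq_fract)
  have cop: "coprime p' q'"
    unfolding p'_def q'_def by (rule coprime_quot_of_fract)
  have "q' dvd p' * q" by (simp add: eq)
  then have "q' dvd q"
    using cop by (simp add: coprime_dvd_mult_right_iff coprime_commute)
  then show nz: "poly (snd (quot_of_fract (Fract p q))) z \<noteq> 0"
    using assms unfolding q'_def[symmetric] by (auto elim!: dvdE)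
  have "poly p' z * poly q z = poly p z * poly q' z"
    using eq by (metis poly_mult)
  then show "ratfun_eval (Fract p q) z = poly p z / poly q z"
    using nz assms unfolding ratfun_eval_def p'_def[symmetric] q'_def[symmetric]
    by (simp add: field_simps)
qed


lemma poly_has_fps_expansion: "poly p has_fps_expansion fps_of_poly (p :: complex poly)"
proof (induction p)
  case 0
  have "poly 0 = (\<lambda>_. 0 :: complex)"
    by (rule ext) simp
  then show ?case
    by (simp only: fps_of_poly_0 has_fps_expansion_0)
next
  case (pCons a p)
  have "(\<lambda>x. a + x * poly p x) has_fps_expansion fps_const a + fps_X * fps_of_poly p"
    by (intro fps_expansion_intros pCons.IH)
  then show ?case
    by (simp add: fps_of_poly_pCons mult.commute add.commute)
qed

lemma ratfun_eval_has_fps_expansion: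
  assumes "poly (snd (quot_of_fract f)) 0 \<noteq> 0"
  shows "ratfun_eval f has_fps_expansion
    fps_of_poly (fst (quot_of_fract f)) / fps_of_poly (snd (quot_of_fract f))"
  unfolding ratfun_eval_def
  using assms by (intro has_fps_expansion_divide' poly_has_fps_expansion) (simp add: poly_0_coeff_0)

lemma ratfun_analytic_iff: "ratfun_analytic f \<longleftrightarrow> poly (snd (quot_of_fract f)) 0 \<noteq> 0"
proof
  assume "poly (snd (quot_of_fract f)) 0 \<noteq> 0"
  then show "ratfun_analytic f"
    unfolding ratfun_analytic_def
    using has_fps_expansion_imp_analytic_0 ratfun_eval_has_fps_expansion by blast
next
  assume an: "ratfun_analytic f"
  define p where "p = fst (quot_of_fract f)"
  define q where "q = snd (quot_of_fract f)"
  show "poly (snd (quot_of_fract f)) 0 \<noteq> 0"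
  proof
    assume "poly (snd (quot_of_fract f)) 0 = 0"
    then have q0: "poly q 0 = 0" by (simp add: q_def)
    have "q \<noteq> 0" by (simp add: q_def)
    have cop: "coprime p q"
      unfolding p_def q_def by (rule coprime_quot_of_fract)
    have p0: "poly p 0 \<noteq> 0"
    proof
      assume "poly p 0 = 0"
      then have "[:0, 1:] dvd p" "[:0, 1:] dvd q"
        using q0 poly_eq_0_iff_dvd[of _ 0] by auto
      then have "is_unit [:0, 1 :: complex:]"
        using cop coprime_common_divisor by blast
      then show False
        by (simp add: is_unit_iff_degree)
    qed
    have "isCont (ratfun_eval f) 0"
      using an unfolding ratfun_analytic_def
      by (simp add: analytic_at_imp_isCont)
    then have "isCont (\<lambda>z. ratfun_eval f z * poly q z) 0"
      by (intro continuous_intros) auto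
    then have "((\<lambda>z. ratfun_eval f z * poly q z) \<longlongrightarrow> 0) (at 0)"
      using q0 by (simp add: isCont_def)
    moreover have "\<forall>\<^sub>F z in at 0. ratfun_eval f z * poly q z = poly p z"
    proof -
      have "finite {z. poly q z = 0}"
        using \<open>q \<noteq> 0\<close> by (rule poly_roots_finite)
      then have "open (- ({z. poly q z = 0} - {0}))"
        by (intro open_Compl finite_imp_closed finite_Diff)
      then have "\<forall>\<^sub>F z in at 0. z \<in> - ({z. poly q z = 0} - {0})"
        by (intro eventually_at_in_open') auto
      moreover have "\<forall>\<^sub>F z in at (0 :: complex). z \<noteq> 0"
        by (simp add: eventually_at_filter)
      ultimately show ?thesis
        by eventually_elim (auto simp: ratfun_eval_def p_def q_def)
    qed
    ultimately have "(poly p \<longlongrightarrow> 0) (at 0)"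
      by (rule Lim_transform_eventually)
    moreover have "(poly p \<longlongrightarrow> poly p 0) (at 0)"
      using has_fps_expansion_imp_continuous[OF poly_has_fps_expansion[of p], of UNIV]
      by (simp add: isCont_def)
    ultimately show False
      using p0 tendsto_unique[of "at (0::complex)"] by fastforce
  qed
qed

lemma ratfun_analyticE:
  assumes "ratfun_analytic f"
  obtains p q where "poly q 0 \<noteq> 0" "f = Fract p q"
  using assms Fract_quot_of_fract[of f] unfolding ratfun_analytic_iff by metis

lemma ratfun_analytic_Fract: "poly q 0 \<noteq> 0 \<Longrightarrow> ratfun_analytic (Fract p q)"
  using ratfun_eval_Fract(2) by (simp add: ratfun_analytic_iff)

lemma ratfun_taylor_Fract:
  assumes "poly q 0 \<noteq> 0"
  shows "ratfun_taylor (Fract p q) * fps_of_poly q = fps_of_poly p"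
proof -
  define p' where "p' = fst (quot_of_fract (Fract p q))"
  define q' where "q' = snd (quot_of_fract (Fract p q))"
  have q: "q \<noteq> 0" using assms by auto
  have q': "q' \<noteq> 0" by (simp add: q'_def)
  have nz: "poly q' 0 \<noteq> 0"
    unfolding q'_def using assms by (rule ratfun_eval_Fract(2))
  have "Fract p' q' = Fract p q"
    by (simp add: p'_def q'_def)
  then have "p' * q = p * q'"
    using q q' by (simp add: eq_fract)
  then have eq: "fps_of_poly p' * fps_of_poly q = fps_of_poly p * fps_of_poly q'"
    by (metis fps_of_poly_mult)
  have "ratfun_taylor (Fract p q) = fps_of_poly p' / fps_of_poly q'"
    unfolding ratfun_taylor_def p'_def q'_def
    by (intro fps_expansion_eqI ratfun_eval_has_fps_expansion ratfun_eval_Fract(2) assms)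
  then have "ratfun_taylor (Fract p q) * fps_of_poly q' = fps_of_poly p'"
    using nz by (simp add: fps_divide_unit poly_0_coeff_0 mult.assoc inverse_mult_eq_1)
  then have "ratfun_taylor (Fract p q) * fps_of_poly q * fps_of_poly q'
      = fps_of_poly p * fps_of_poly q'"
    by (metis eq mult.assoc mult.commute)
  then show ?thesis
    using q' by simp
qed

lemma ratfun_taylor_eqI:
  assumes "poly q 0 \<noteq> 0" "F * fps_of_poly q = fps_of_poly p"
  shows "ratfun_taylor (Fract p q) = F"
proof -
  have "q \<noteq> 0" using assms by auto
  then have "fps_of_poly q \<noteq> 0" by simp
  moreover have "ratfun_taylor (Fract p q) * fps_of_poly q = F * fps_of_poly q"
    using ratfun_taylor_Fract[OF assms(1), of p] assms(2) by simp
  ultimately show ?thesis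
    by simp
qed

lemma ratfun_taylor_inject:
  assumes "ratfun_analytic f" "ratfun_analytic g" "ratfun_taylor f = ratfun_taylor g"
  shows "f = g"
proof -
  obtain p q where f: "poly q 0 \<noteq> 0" "f = Fract p q"
    using assms(1) by (rule ratfun_analyticE)
  obtain r s where g: "poly s 0 \<noteq> 0" "g = Fract r s"
    using assms(2) by (rule ratfun_analyticE)
  have nz: "q \<noteq> 0" "s \<noteq> 0" using f g by auto
  have "fps_of_poly p * fps_of_poly s = fps_of_poly r * fps_of_poly q"
    using ratfun_taylor_Fract[OF f(1), of p] ratfun_taylor_Fract[OF g(1), of r] assms(3) f g
    by (metis mult.assoc mult.commute)
  then have "p * s = r * q"
    by (metis fps_of_poly_mult fps_of_poly_eq_iff)
  then show ?thesis
    using f g nz by (simp add: eq_fract)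
qed

lemma ratfun_analytic_0 [simp]: "ratfun_analytic 0"
  by (simp add: ratfun_analytic_iff)

lemma ratfun_taylor_0 [simp]: "ratfun_taylor 0 = 0"
  using ratfun_taylor_eqI[of 1 0 0] by (simp add: Zero_fract_def)

lemma ratfun_add:
  assumes "ratfun_analytic f" "ratfun_analytic g"
  shows "ratfun_analytic (f + g)" "ratfun_taylor (f + g) = ratfun_taylor f + ratfun_taylor g"
proof -
  obtain p q where f: "poly q 0 \<noteq> 0" "f = Fract p q"
    using assms(1) by (rule ratfun_analyticE)
  obtain r s where g: "poly s 0 \<noteq> 0" "g = Fract r s"
    using assms(2) by (rule ratfun_analyticE)
  have nz: "q \<noteq> 0" "s \<noteq> 0" using f g by auto
  have nz0: "poly (q * s) 0 \<noteq> 0" using f g by simp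
  have fg: "f + g = Fract (p * s + r * q) (q * s)"
    using f g nz by simp
  show "ratfun_analytic (f + g)"
    unfolding fg using nz0 by (rule ratfun_analytic_Fract)
  have "(ratfun_taylor f + ratfun_taylor g) * fps_of_poly (q * s)
      = (ratfun_taylor f * fps_of_poly q) * fps_of_poly s
        + (ratfun_taylor g * fps_of_poly s) * fps_of_poly q"
    by (simp add: fps_of_poly_mult algebra_simps)
  also have "\<dots> = fps_of_poly (p * s + r * q)"
    using ratfun_taylor_Fract[OF f(1), of p] ratfun_taylor_Fract[OF g(1), of r] f g
    by (simp add: fps_of_poly_mult fps_of_poly_add)
  finally show "ratfun_taylor (f + g) = ratfun_taylor f + ratfun_taylor g"
    unfolding fg using nz0 by (intro ratfun_taylor_eqI)
qed

lemma ratfun_scale: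
  assumes "ratfun_analytic f"
  shows "ratfun_analytic (ratfun_scale c f)"
    "ratfun_taylor (ratfun_scale c f) = fps_const c * ratfun_taylor f"
proof -
  obtain p q where f: "poly q 0 \<noteq> 0" "f = Fract p q"
    using assms(1) by (rule ratfun_analyticE)
  have cf: "ratfun_scale c f = Fract ([:c:] * p) q"
    using f by (simp add: ratfun_scale_def to_fract_def)
  show "ratfun_analytic (ratfun_scale c f)"
    unfolding cf using f(1) by (rule ratfun_analytic_Fract)
  have "fps_const c * ratfun_taylor f * fps_of_poly q = fps_of_poly ([:c:] * p)"
    using ratfun_taylor_Fract[OF f(1), of p] f
    by (simp add: mult.assoc fps_of_poly_smult)
  then show "ratfun_taylor (ratfun_scale c f) = fps_const c * ratfun_taylor f"
    unfolding cf using f(1) by (intro ratfun_taylor_eqI)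
qed


subsection \<open>Well-definedness of the space and of the operator\<close>

lemma ratfun_taylor_exists:
  assumes "L > 0" "\<And>k. a (k + L) = (a k :: complex)"
  shows "\<exists>f. ratfun_analytic f \<and> ratfun_taylor f = Abs_fps (\<lambda>k. of_nat k ^ m * a k)"
proof -
  have "\<exists>p q :: complex poly. poly q 0 \<noteq> 0 \<and>
      Abs_fps (\<lambda>k. of_nat k ^ m * a k) * fps_of_poly q = fps_of_poly p"
  proof (induction m)
    case 0
    define q :: "complex poly" where "q = 1 - monom 1 L"
    define p where "p = (\<Sum>k<L. monom (a k) k)"
    have q: "fps_of_poly q = 1 - fps_X ^ L"
      by (simp add: q_def fps_of_poly_diff fps_of_poly_monom)
    have "Abs_fps (\<lambda>k. of_nat k ^ 0 * a k) * fps_of_poly q = fps_of_poly p"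
    proof (rule fps_ext)
      fix k
      have "fps_nth (fps_of_poly p) k = (if k < L then a k else 0)"
        by (simp add: p_def coeff_sum)
      moreover have "fps_nth (Abs_fps (\<lambda>k. of_nat k ^ 0 * a k) * fps_of_poly q) k
          = a k - (if k < L then 0 else a (k - L))"
        unfolding q by (simp add: algebra_simps fps_X_power_mult_right_nth)
      moreover have "a k = a (k - L)" if "\<not> k < L"
        using assms(2)[of "k - L"] that by simp
      ultimately show "fps_nth (Abs_fps (\<lambda>k. of_nat k ^ 0 * a k) * fps_of_poly q) k
          = fps_nth (fps_of_poly p) k"
        by simp
    qed
    moreover have "poly q 0 \<noteq> 0"
      using assms(1) by (simp add: q_def poly_monom power_0_left)
    ultimately show ?case by blast
  next
    case (Suc m)
    define F where "F = Abs_fps (\<lambda>k. of_nat k ^ m * a k)"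
    obtain p q :: "complex poly" where pq: "poly q 0 \<noteq> 0" "F * fps_of_poly q = fps_of_poly p"
      using Suc.IH unfolding F_def by blast
    have "fps_deriv F * fps_of_poly q + F * fps_deriv (fps_of_poly q) = fps_deriv (fps_of_poly p)"
      using arg_cong[OF pq(2), of fps_deriv] by (simp add: algebra_simps)
    then have d: "fps_deriv F * fps_of_poly q + F * fps_of_poly (pderiv q) = fps_of_poly (pderiv p)"
      by (simp add: fps_of_poly_pderiv)
    have "fps_X * fps_deriv F * fps_of_poly (q * q)
        = fps_X * ((fps_deriv F * fps_of_poly q + F * fps_of_poly (pderiv q)) * fps_of_poly q
          - F * fps_of_poly q * fps_of_poly (pderiv q))"
      by (simp add: fps_of_poly_mult algebra_simps)
    also have "\<dots> = fps_of_poly ([:0, 1:] * (pderiv p * q - p * pderiv q))"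
      unfolding d pq(2) by (simp only: fps_of_poly_mult fps_of_poly_diff fps_of_poly_fps_X)
    finally have "fps_X * fps_deriv F * fps_of_poly (q * q)
        = fps_of_poly ([:0, 1:] * (pderiv p * q - p * pderiv q))" .
    moreover have "Abs_fps (\<lambda>k. of_nat k ^ Suc m * a k) = fps_X * fps_deriv F"
      by (rule fps_ext) (auto simp: F_def)
    moreover have "poly (q * q) 0 \<noteq> 0"
      using pq by simp
    ultimately show ?case by metis
  qed
  then show ?thesis
    using ratfun_analytic_Fract ratfun_taylor_eqI by metis
qed

lemma RLk_subspace: "ratfun_subspace (RLk L \<kappa>)"
proof (rule ratfun.subspaceI)
  show "0 \<in> RLk L \<kappa>"
    by (auto simp: RLk_def fps_eq_iff intro!: exI[of _ "\<lambda>_. 0"])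
next
  fix f g assume "f \<in> RLk L \<kappa>" "g \<in> RLk L \<kappa>"
  then obtain a b where ab: "ratfun_analytic f" "ratfun_analytic g"
      "\<And>k. a (k + L) = (a k :: complex)" "\<And>k. b (k + L) = (b k :: complex)"
      "ratfun_taylor f = Abs_fps (\<lambda>k. of_nat k ^ (\<kappa> - 1) * a k)"
      "ratfun_taylor g = Abs_fps (\<lambda>k. of_nat k ^ (\<kappa> - 1) * b k)"
    by (auto simp: RLk_def)
  then show "f + g \<in> RLk L \<kappa>"
    by (auto simp: RLk_def ratfun_add fps_eq_iff algebra_simps intro!: exI[of _ "\<lambda>k. a k + b k"])
next
  fix c f assume "f \<in> RLk L \<kappa>"
  then obtain a where a: "ratfun_analytic f" "\<And>k. a (k + L) = (a k :: complex)"
      "ratfun_taylor f = Abs_fps (\<lambda>k. of_nat k ^ (\<kappa> - 1) * a k)"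
    by (auto simp: RLk_def)
  then show "ratfun_scale c f \<in> RLk L \<kappa>"
    by (auto simp: RLk_def ratfun_scale fps_eq_iff intro!: exI[of _ "\<lambda>k. c * a k"])
qed

lemma U_op_eqI:
  assumes "ratfun_analytic g" "ratfun_taylor g = U_series n (ratfun_taylor f)"
  shows "U_op n f = g"
  unfolding U_op_def using assms ratfun_taylor_inject by (intro the_equality) auto

lemma
  assumes "L > 0" "f \<in> RLk L \<kappa>"
  shows U_op_in_RLk: "U_op n f \<in> RLk L \<kappa>"
    and ratfun_taylor_U_op: "ratfun_taylor (U_op n f) = U_series n (ratfun_taylor f)"
proof -
  obtain a where a: "\<And>k. a (k + L) = (a k :: complex)"
      "ratfun_taylor f = Abs_fps (\<lambda>k. of_nat k ^ (\<kappa> - 1) * a k)"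
    using assms(2) by (auto simp: RLk_def)
  define b where "b k = of_nat n ^ (\<kappa> - 1) * a (n * k)" for k
  have "a (k + j * L) = a k" for k j
    by (induction j) (use a(1) in \<open>simp_all add: add.assoc[symmetric] add.commute[of L]\<close>)
  then have b: "b (k + L) = b k" for k
    by (simp add: b_def distrib_left)
  have U: "U_series n (ratfun_taylor f) = Abs_fps (\<lambda>k. of_nat k ^ (\<kappa> - 1) * b k)"
    by (simp add: U_series_def a(2) b_def fps_eq_iff power_mult_distrib)
  obtain g where g: "ratfun_analytic g" "ratfun_taylor g = Abs_fps (\<lambda>k. of_nat k ^ (\<kappa> - 1) * b k)"
    using ratfun_taylor_exists[of L b "\<kappa> - 1"] assms(1) b by blast
  have "U_op n f = g"
    using g U by (intro U_op_eqI) auto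
  then show "U_op n f \<in> RLk L \<kappa>" "ratfun_taylor (U_op n f) = U_series n (ratfun_taylor f)"
    using g U b by (auto simp: RLk_def)
qed

lemma U_op_linear:
  assumes "L > 0" "f \<in> RLk L \<kappa>" "g \<in> RLk L \<kappa>"
  shows "U_op n (f + g) = U_op n f + U_op n g"
    and "U_op n (ratfun_scale c f) = ratfun_scale c (U_op n f)"
proof -
  have an: "ratfun_analytic f" "ratfun_analytic g"
      "ratfun_analytic (U_op n f)" "ratfun_analytic (U_op n g)"
    using U_op_in_RLk[OF assms(1)] assms(2,3) by (auto simp: RLk_def)
  have t: "ratfun_taylor (U_op n f) = U_series n (ratfun_taylor f)"
      "ratfun_taylor (U_op n g) = U_series n (ratfun_taylor g)"
    using ratfun_taylor_U_op[OF assms(1)] assms(2,3) by auto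
  show "U_op n (f + g) = U_op n f + U_op n g"
    by (rule U_op_eqI) (simp_all add: an t ratfun_add U_series_def fps_eq_iff)
  show "U_op n (ratfun_scale c f) = ratfun_scale c (U_op n f)"
    by (rule U_op_eqI) (simp_all add: an t ratfun_scale U_series_def fps_eq_iff)
qed

end

theory Submission
  imports Defs
begin

text \<open>
  An element of \<open>RLk L \<kappa>\<close> is the same thing as an \<open>L\<close>-periodic sequence \<open>a\<close>: its Taylor
  coefficients \<open>k ^ (\<kappa> - 1) * a k\<close> determine \<open>a k\<close> for \<open>k > 0\<close>, hence everywhere by periodicity.
  The operator \<open>U\<^sub>n\<close> kills it precisely when \<open>a\<close> vanishes at all positive multiples of \<open>n\<close>. Modulo
  \<open>L\<close> these are the multiples of \<open>gcd n L\<close>, so the kernel consists of the periodic sequences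
  that vanish on the multiples of \<open>gcd n L\<close> (lemma \<open>U_ker_iff\<close>). The functions belonging to the
  indicator sequences of the residue classes \<open>r < L\<close> with \<open>\<not> gcd n L dvd r\<close> are therefore a
  basis of it, and exactly \<open>L div gcd n L\<close> residue classes are left out.
\<close>

lemma periodic_add_mult:
  fixes a :: "nat \<Rightarrow> 'a"
  assumes "\<And>k. a (k + L) = a k"
  shows "a (k + j * L) = a k"
  by (induction j) (use assms in \<open>simp_all add: add.assoc[symmetric] add.commute[of L]\<close>)

lemma periodic_mod:
  fixes a :: "nat \<Rightarrow> 'a"
  assumes "\<And>k. a (k + L) = a k"
  shows "a (k mod L) = a k"
  using periodic_add_mult[of a L "k mod L" "k div L"] assms by simp

text \<open>
  By Bezout, the multiples of \<open>n\<close> and of \<open>gcd n L\<close> agree modulo \<open>L\<close>. The positivity of \<open>j\<close>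
  matters because for \<open>\<kappa> > 1\<close> the constant Taylor coefficient carries no information about \<open>a 0\<close>.
\<close>
lemma gcd_multiple_cong_multiple:
  fixes n L k :: nat
  assumes "n > 0" "L > 0" "gcd n L dvd k"
  obtains i j where "j > 0" "n * j = k + i * L"
proof -
  obtain x y where xy: "n * x = L * y + gcd n L"
    using bezout_nat[of n L] assms(1) by auto
  obtain t where t: "k = gcd n L * t"
    using assms(3) by (rule dvdE)
  have "n * (x * t + L) = n * x * t + n * L"
    by (simp add: algebra_simps)
  also have "\<dots> = k + (y * t + n) * L"
    unfolding xy t by (simp add: algebra_simps)
  finally show thesis
    using that[of "x * t + L"] assms(2) by simp
qed

lemma U_ker_iff:
  assumes "n > 0" "L > 0" "f \<in> RLk L \<kappa>"
    and periodic: "\<And>k. a (k + L) = (a k :: complex)"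
    and taylor: "ratfun_taylor f = Abs_fps (\<lambda>k. of_nat k ^ (\<kappa> - 1) * a k)"
  shows "f \<in> U_ker n L \<kappa> \<longleftrightarrow> (\<forall>k. gcd n L dvd k \<longrightarrow> a k = 0)"
proof
  assume "f \<in> U_ker n L \<kappa>"
  then have "U_series n (ratfun_taylor f) = 0"
    using ratfun_taylor_U_op[OF assms(2,3), of n] by (simp add: U_ker_def)
  then have zero: "of_nat (n * j) ^ (\<kappa> - 1) * a (n * j) = 0" for j
    by (simp add: U_series_def taylor fps_eq_iff)
  show "\<forall>k. gcd n L dvd k \<longrightarrow> a k = 0"
  proof (intro allI impI)
    fix k assume "gcd n L dvd k"
    then obtain i j where ij: "j > 0" "n * j = k + i * L"
      by (rule gcd_multiple_cong_multiple[OF assms(1,2)])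
    have "of_nat (n * j) \<noteq> (0 :: complex)"
      unfolding of_nat_eq_0_iff using ij(1) assms(1) by simp
    then have "a (n * j) = 0"
      using zero[of j] by (simp del: of_nat_mult)
    then show "a k = 0"
      using ij(2) periodic_add_mult[of a L k i] periodic by simp
  qed
next
  assume "\<forall>k. gcd n L dvd k \<longrightarrow> a k = 0"
  then have "U_series n (ratfun_taylor f) = 0"
    by (simp add: U_series_def taylor fps_eq_iff)
  then have "U_op n f = 0"
    by (intro U_op_eqI) simp_all
  then show "f \<in> U_ker n L \<kappa>"
    using assms(3) by (simp add: U_ker_def)
qed

lemma ratfun_lincomb:
  assumes "finite S" "\<And>r. r \<in> S \<Longrightarrow> ratfun_analytic (e r)"
  shows "ratfun_analytic (\<Sum>r\<in>S. ratfun_scale (c r) (e r)) \<and>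
    ratfun_taylor (\<Sum>r\<in>S. ratfun_scale (c r) (e r)) =
      (\<Sum>r\<in>S. fps_const (c r) * ratfun_taylor (e r))"
  using assms by (induction S rule: finite_induct) (simp_all add: ratfun_add ratfun_scale)

definition residue_fun :: "nat \<Rightarrow> nat \<Rightarrow> nat \<Rightarrow> ratfun" where
  "residue_fun L \<kappa> r = (SOME f. ratfun_analytic f \<and>
     ratfun_taylor f = Abs_fps (\<lambda>k. of_nat k ^ (\<kappa> - 1) * of_bool (k mod L = r)))"

lemma residue_fun:
  assumes "L > 0"
  shows "ratfun_analytic (residue_fun L \<kappa> r)"
    and "ratfun_taylor (residue_fun L \<kappa> r) =
      Abs_fps (\<lambda>k. of_nat k ^ (\<kappa> - 1) * of_bool (k mod L = r))"
proof -
  have "\<exists>f. ratfun_analytic f \<and>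
      ratfun_taylor f = Abs_fps (\<lambda>k. of_nat k ^ (\<kappa> - 1) * of_bool (k mod L = r))"
    by (rule ratfun_taylor_exists[OF assms]) simp
  from someI_ex[OF this]
  show "ratfun_analytic (residue_fun L \<kappa> r)"
    "ratfun_taylor (residue_fun L \<kappa> r) =
      Abs_fps (\<lambda>k. of_nat k ^ (\<kappa> - 1) * of_bool (k mod L = r))"
    unfolding residue_fun_def by blast+
qed

lemma residue_fun_lincomb:
  assumes "L > 0" "finite S"
  shows "ratfun_analytic (\<Sum>r\<in>S. ratfun_scale (c r) (residue_fun L \<kappa> r))"
    and "fps_nth (ratfun_taylor (\<Sum>r\<in>S. ratfun_scale (c r) (residue_fun L \<kappa> r))) k =
      of_nat k ^ (\<kappa> - 1) * (if k mod L \<in> S then c (k mod L) else 0)"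
proof -
  note lc = ratfun_lincomb[of S "residue_fun L \<kappa>" c, OF assms(2) residue_fun(1)[OF assms(1)]]
  show "ratfun_analytic (\<Sum>r\<in>S. ratfun_scale (c r) (residue_fun L \<kappa> r))"
    using lc by simp
  have "fps_nth (ratfun_taylor (\<Sum>r\<in>S. ratfun_scale (c r) (residue_fun L \<kappa> r))) k =
      (\<Sum>r\<in>S. c r * (of_nat k ^ (\<kappa> - 1) * of_bool (k mod L = r)))"
    using lc by (simp add: fps_sum_nth residue_fun(2)[OF assms(1)])
  also have "\<dots> = (\<Sum>r\<in>S. if k mod L = r then of_nat k ^ (\<kappa> - 1) * c r else 0)"
    by (intro sum.cong) auto
  also have "\<dots> = of_nat k ^ (\<kappa> - 1) * (if k mod L \<in> S then c (k mod L) else 0)"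
    using assms(2) by simp
  finally show "fps_nth (ratfun_taylor (\<Sum>r\<in>S. ratfun_scale (c r) (residue_fun L \<kappa> r))) k =
      of_nat k ^ (\<kappa> - 1) * (if k mod L \<in> S then c (k mod L) else 0)" .
qed

text \<open>
  The coefficient of a linear combination at \<open>r + L\<close> is a nonzero multiple of the scalar at \<open>r\<close>;
  the coefficient at \<open>r\<close> itself vanishes for every choice of scalars if \<open>r = 0\<close> and \<open>\<kappa> > 1\<close>.
\<close>
lemma residue_fun_scalars_zero:
  assumes "L > 0" "S \<subseteq> {..<L}" "r \<in> S"
    and "(\<Sum>r\<in>S. ratfun_scale (c r) (residue_fun L \<kappa> r)) = 0"
  shows "c r = 0"
proof -
  have "finite S" using assms(2) finite_subset by blast
  have "(r + L) mod L = r"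
    using assms(2,3) by auto
  then have "of_nat (r + L) ^ (\<kappa> - 1) * c r = 0"
    using residue_fun_lincomb(2)[OF assms(1) \<open>finite S\<close>, of c \<kappa> "r + L"] assms(3,4) by simp
  moreover have "of_nat (r + L) \<noteq> (0 :: complex)"
    unfolding of_nat_eq_0_iff using assms(1) by simp
  ultimately show "c r = 0"
    by simp
qed

lemma inj_on_residue_fun:
  assumes "L > 0"
  shows "inj_on (residue_fun L \<kappa>) {..<L}"
proof (rule inj_onI, rule ccontr)
  fix r s assume rs: "r \<in> {..<L}" "s \<in> {..<L}" "residue_fun L \<kappa> r = residue_fun L \<kappa> s" "r \<noteq> s"
  define c where "c t = (if t = r then 1 else - 1 :: complex)" for t
  have "(\<Sum>t\<in>{r, s}. ratfun_scale (c t) (residue_fun L \<kappa> t)) = 0"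
    using rs by (simp add: c_def)
  then have "c r = 0"
    using residue_fun_scalars_zero[OF assms, of "{r, s}" r c \<kappa>] rs by simp
  then show False
    by (simp add: c_def)
qed

lemma independent_residue_fun:
  assumes "L > 0" "S \<subseteq> {..<L}"
  shows "ratfun.independent (residue_fun L \<kappa> ` S)"
proof (rule ratfun.independent_if_scalars_zero)
  show "finite (residue_fun L \<kappa> ` S)"
    using assms(2) finite_subset by blast
next
  fix c f
  assume sum: "(\<Sum>f\<in>residue_fun L \<kappa> ` S. ratfun_scale (c f) f) = 0"
    and "f \<in> residue_fun L \<kappa> ` S"
  then obtain r where r: "r \<in> S" "f = residue_fun L \<kappa> r"
    by blast
  have "inj_on (residue_fun L \<kappa>) S"
    using inj_on_residue_fun[OF assms(1)] assms(2) inj_on_subset by blast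
  then have "(\<Sum>r\<in>S. ratfun_scale (c (residue_fun L \<kappa> r)) (residue_fun L \<kappa> r)) = 0"
    using sum by (simp add: sum.reindex)
  then show "c f = 0"
    using residue_fun_scalars_zero[OF assms r(1), of "\<lambda>r. c (residue_fun L \<kappa> r)"] r(2) by simp
qed

lemma residue_fun_in_U_ker:
  assumes "n > 0" "L > 0" "\<not> gcd n L dvd r"
  shows "residue_fun L \<kappa> r \<in> U_ker n L \<kappa>"
proof -
  have "residue_fun L \<kappa> r \<in> RLk L \<kappa>"
    unfolding RLk_def
    using residue_fun[OF assms(2)] by (auto intro!: exI[of _ "\<lambda>k. of_bool (k mod L = r)"])
  moreover have "k mod L \<noteq> r" if "gcd n L dvd k" for k
    using assms(3) that by (auto simp: dvd_mod)
  ultimately show ?thesis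
    by (subst U_ker_iff[OF assms(1,2) _ _ residue_fun(2)[OF assms(2)]]) auto
qed

lemma U_ker_subset_span:
  assumes "n > 0" "L > 0"
  shows "U_ker n L \<kappa> \<subseteq> ratfun_span (residue_fun L \<kappa> ` {r. r < L \<and> \<not> gcd n L dvd r})"
proof
  define S where "S = {r. r < L \<and> \<not> gcd n L dvd r}"
  have "finite S" by (simp add: S_def)
  fix f assume f: "f \<in> U_ker n L \<kappa>"
  then have R: "f \<in> RLk L \<kappa>"
    by (simp add: U_ker_def)
  then obtain a where a: "ratfun_analytic f" "\<And>k. a (k + L) = (a k :: complex)"
      "ratfun_taylor f = Abs_fps (\<lambda>k. of_nat k ^ (\<kappa> - 1) * a k)"
    by (auto simp: RLk_def)
  have zero: "a k = 0" if "gcd n L dvd k" for k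
    using U_ker_iff[OF assms R a(2,3)] f that by simp
  have "(if k mod L \<in> S then a (k mod L) else 0) = a k" for k
  proof -
    have "a k = 0" if "k mod L \<notin> S"
      using that assms(2) zero[of "k mod L"] periodic_mod[of a L k] a(2) by (auto simp: S_def)
    then show ?thesis
      using periodic_mod[of a L k] a(2) by auto
  qed
  then have "ratfun_taylor f = ratfun_taylor (\<Sum>r\<in>S. ratfun_scale (a r) (residue_fun L \<kappa> r))"
    by (simp add: fps_eq_iff a(3) residue_fun_lincomb(2)[OF assms(2) \<open>finite S\<close>])
  then have "f = (\<Sum>r\<in>S. ratfun_scale (a r) (residue_fun L \<kappa> r))"
    using a(1) residue_fun_lincomb(1)[OF assms(2) \<open>finite S\<close>] ratfun_taylor_inject by blast
  also have "\<dots> \<in> ratfun_span (residue_fun L \<kappa> ` S)"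
    by (intro ratfun.span_sum ratfun.span_scale ratfun.span_base) auto
  finally show "f \<in> ratfun_span (residue_fun L \<kappa> ` {r. r < L \<and> \<not> gcd n L dvd r})"
    by (simp add: S_def)
qed

lemma card_nonmultiples:
  fixes d L :: nat
  assumes "d > 0" "d dvd L"
  shows "card {r. r < L \<and> \<not> d dvd r} = L - L div d"
proof -
  have "{r. r < L \<and> d dvd r} = (\<lambda>i. d * i) ` {..<L div d}"
    using assms by (auto elim!: dvdE)
  moreover have "inj_on (\<lambda>i. d * i) {..<L div d}"
    using assms(1) by (simp add: inj_on_def)
  ultimately have "card {r. r < L \<and> d dvd r} = L div d"
    by (simp add: card_image)
  moreover have "{r. r < L \<and> \<not> d dvd r} = {..<L} - {r. r < L \<and> d dvd r}"
    by auto
  ultimately show ?thesis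
    by (simp add: card_Diff_subset subset_iff)
qed

theorem corollary14:
  fixes n L \<kappa> :: nat
  assumes "n > 0" and "L > 0" and "\<kappa> > 0"
  shows "(\<exists>B. finite B \<and> U_ker n L \<kappa> \<subseteq> ratfun_span B) \<and>
    real (ratfun_dim (U_ker n L \<kappa>)) = real L - real L / real (gcd n L)"
proof
  define S where "S = {r. r < L \<and> \<not> gcd n L dvd r}"
  let ?B = "residue_fun L \<kappa> ` S"
  have S: "S \<subseteq> {..<L}" "finite S"
    by (auto simp: S_def)
  have span: "U_ker n L \<kappa> \<subseteq> ratfun_span ?B"
    unfolding S_def using assms(1,2) by (rule U_ker_subset_span)
  then show "\<exists>B. finite B \<and> U_ker n L \<kappa> \<subseteq> ratfun_span B"
    using S(2) by blast
  have "card ?B = card S"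
    using inj_on_residue_fun[OF assms(2)] S(1) by (meson card_image inj_on_subset)
  moreover have "?B \<subseteq> U_ker n L \<kappa>"
    using residue_fun_in_U_ker[OF assms(1,2)] by (auto simp: S_def)
  ultimately have "ratfun_dim (U_ker n L \<kappa>) = card S"
    using span independent_residue_fun[OF assms(2) S(1)] ratfun.dim_unique by blast
  also have "\<dots> = L - L div gcd n L"
    unfolding S_def using assms(1) by (intro card_nonmultiples) auto
  finally show "real (ratfun_dim (U_ker n L \<kappa>)) = real L - real L / real (gcd n L)"
    by (simp add: of_nat_diff real_of_nat_div)
qed

end
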